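(* For XCCS processes, if $P \equiv_r Q$, then $P \sim Q$.
   Context: XCCS processes: $P ::= {\bf 0} \mid END \mid \alpha.P \mid P_1;P_2 \mid P_1+P_2 \mid P_1|P_2 \mid P^* \mid P\backslash L$, with running actions $\alpha ::= a\mid\overline a\mid\tau$ and an ending action $END$. Transition rules (with $\mathrm{Done}$ = successful termination): $\alpha.P\stackrel{\alpha}{\to}P$; $END\stackrel{END}{\to}\mathrm{Done}$; $P^*\stackrel{END}{\to}\mathrm{Done}$; if $P\stackrel{\alpha}{\to}P'$ then $P;Q\stackrel{\alpha}{\to}P';Q$ and $P^*\stackrel{\alpha}{\to}P';P^*$; if $P\stackrel{END}{\to}\mathrm{Done}$ and $Q\stackrel{\alpha}{\to}Q'$ then $P;Q\stackrel{\alpha}{\to}Q'$; sums and parallel composition as in CCS (interleaving plus $\tau$-communication on complementary actions); $P\backslash L$ performs the moves of $P$ outside $L\cup\overline L$; $P;Q$ and $P|Q$ do $END$ if both components do, $P+Q$ if either does, $P\backslash L$ if $P$ does. ${\bf 0}$ has no transitions. Strong bisimulation: $(P,Q)\in Z$ implies running-action transitions are matched into $Z$ both ways, and $P\stackrel{END}{\to}\mathrm{Done}$ iff $Q\stackrel{END}{\to}\mathrm{Done}$; $\sim$ is the union of strong bisimulations. $\equiv_r$ (r-congruence) is the smallest congruence (equivalence preserved by all XCCS operators), closed under alpha conversion of restricted names, with: ${\bf 0}\backslash L\equiv_r{\bf 0}$; $END\backslash L\equiv_r END$; $(\alpha.P)\backslash L\equiv_r\alpha.(P\backslash L)$ if $\alpha\notin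 L\cup\overline L$ and $\equiv_r{\bf 0}$ otherwise; $(P;Q)\backslash L\equiv_r(P\backslash L);(Q\backslash L)$; $(P+Q)\backslash L\equiv_r(P\backslash L)+(Q\backslash L)$; $P|(Q\backslash L)\equiv_r(P|Q)\backslash L$ if no name of $P$ lies in $L$; $(P^* )\backslash L\equiv_r(P\backslash L)^*$; $P\backslash L\backslash M\equiv_r P\backslash(L\cup M)$; $P\backslash L\equiv_r P$ if no name of $P$ lies in $L$. *)

theory Defs
  imports Main
begin

text \<open>
  The type variable \<open>'n\<close> is the type of names. A restriction set \<open>L\<close> is an arbitrary set of names.
\<close>

datatype 'n act = In 'n | Out 'n | Tau

fun co :: "'n act \<Rightarrow> 'n act" where
  "co (In a) = Out a"
| "co (Out a) = In a"
| "co Tau = Tau"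

fun act_names :: "'n act \<Rightarrow> 'n set" where
  "act_names (In a) = {a}"
| "act_names (Out a) = {a}"
| "act_names Tau = {}"

definition vis :: "'n set \<Rightarrow> 'n act set" where
  \<comment> \<open>the set of actions written as the union of \<open>L\<close> and its set of co-names\<close>
  "vis L = In ` L \<union> co ` In ` L"

datatype 'n xccs =
    Null
  | END
  | Pre "'n act" "'n xccs"
  | Seq "'n xccs" "'n xccs"
  | Sum "'n xccs" "'n xccs"
  | Par "'n xccs" "'n xccs"
  | Star "'n xccs"
  | Res "'n xccs" "'n set"

datatype 'n label = Run "'n act" | Ending

text \<open>\<open>Done\<close> is a target of transitions only; it is not a process term.\<close>

datatype 'n target = Proc "'n xccs" | Done

inductive step :: "'n xccs \<Rightarrow> 'n label \<Rightarrow> 'n target \<Rightarrow> bool"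
  ("_ \<midarrow>_\<rightarrow> _" [61, 0, 61] 60) where
  prefix: "Pre \<alpha> P \<midarrow>Run \<alpha>\<rightarrow> Proc P"
| end_end: "END \<midarrow>Ending\<rightarrow> Done"
| star_end: "Star P \<midarrow>Ending\<rightarrow> Done"
| star: "P \<midarrow>Run \<alpha>\<rightarrow> Proc P' \<Longrightarrow> Star P \<midarrow>Run \<alpha>\<rightarrow> Proc (Seq P' (Star P))"
| seq1: "P \<midarrow>Run \<alpha>\<rightarrow> Proc P' \<Longrightarrow> Seq P Q \<midarrow>Run \<alpha>\<rightarrow> Proc (Seq P' Q)"
| seq2: "P \<midarrow>Ending\<rightarrow> Done \<Longrightarrow> Q \<midarrow>Run \<alpha>\<rightarrow> Proc Q' \<Longrightarrow> Seq P Q \<midarrow>Run \<alpha>\<rightarrow> Proc Q'"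
| seq_end: "P \<midarrow>Ending\<rightarrow> Done \<Longrightarrow> Q \<midarrow>Ending\<rightarrow> Done \<Longrightarrow> Seq P Q \<midarrow>Ending\<rightarrow> Done"
| sum1: "P \<midarrow>Run \<alpha>\<rightarrow> Proc P' \<Longrightarrow> Sum P Q \<midarrow>Run \<alpha>\<rightarrow> Proc P'"
| sum2: "Q \<midarrow>Run \<alpha>\<rightarrow> Proc Q' \<Longrightarrow> Sum P Q \<midarrow>Run \<alpha>\<rightarrow> Proc Q'"
| sum_end1: "P \<midarrow>Ending\<rightarrow> Done \<Longrightarrow> Sum P Q \<midarrow>Ending\<rightarrow> Done"
| sum_end2: "Q \<midarrow>Ending\<rightarrow> Done \<Longrightarrow> Sum P Q \<midarrow>Ending\<rightarrow> Done"
| par1: "P \<midarrow>Run \<alpha>\<rightarrow> Proc P' \<Longrightarrow> Par P Q \<midarrow>Run \<alpha>\<rightarrow> Proc (Par P' Q)"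
| par2: "Q \<midarrow>Run \<alpha>\<rightarrow> Proc Q' \<Longrightarrow> Par P Q \<midarrow>Run \<alpha>\<rightarrow> Proc (Par P Q')"
| comm: "\<alpha> \<noteq> Tau \<Longrightarrow> P \<midarrow>Run \<alpha>\<rightarrow> Proc P' \<Longrightarrow> Q \<midarrow>Run (co \<alpha>)\<rightarrow> Proc Q' \<Longrightarrow>
    Par P Q \<midarrow>Run Tau\<rightarrow> Proc (Par P' Q')"
| par_end: "P \<midarrow>Ending\<rightarrow> Done \<Longrightarrow> Q \<midarrow>Ending\<rightarrow> Done \<Longrightarrow> Par P Q \<midarrow>Ending\<rightarrow> Done"
| res: "P \<midarrow>Run \<alpha>\<rightarrow> Proc P' \<Longrightarrow> \<alpha> \<notin> vis L \<Longrightarrow> Res P L \<midarrow>Run \<alpha>\<rightarrow> Proc (Res P' L)"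
| res_end: "P \<midarrow>Ending\<rightarrow> Done \<Longrightarrow> Res P L \<midarrow>Ending\<rightarrow> Done"

definition strong_bisimulation :: "('n xccs \<times> 'n xccs) set \<Rightarrow> bool" where
  "strong_bisimulation Z \<longleftrightarrow> (\<forall>(P, Q) \<in> Z.
     (\<forall>\<alpha> P'. P \<midarrow>Run \<alpha>\<rightarrow> Proc P' \<longrightarrow> (\<exists>Q'. Q \<midarrow>Run \<alpha>\<rightarrow> Proc Q' \<and> (P', Q') \<in> Z)) \<and>
     (\<forall>\<alpha> Q'. Q \<midarrow>Run \<alpha>\<rightarrow> Proc Q' \<longrightarrow> (\<exists>P'. P \<midarrow>Run \<alpha>\<rightarrow> Proc P' \<and> (P', Q') \<in> Z)) \<and>
     (P \<midarrow>Ending\<rightarrow> Done \<longleftrightarrow> Q \<midarrow>Ending\<rightarrow> Done))"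

definition bisimilar :: "'n xccs \<Rightarrow> 'n xccs \<Rightarrow> bool" (infix "\<sim>" 50) where
  "P \<sim> Q \<longleftrightarrow> (P, Q) \<in> \<Union>{Z. strong_bisimulation Z}"

primrec fn :: "'n xccs \<Rightarrow> 'n set" where
  "fn Null = {}"
| "fn END = {}"
| "fn (Pre \<alpha> P) = act_names \<alpha> \<union> fn P"
| "fn (Seq P Q) = fn P \<union> fn Q"
| "fn (Sum P Q) = fn P \<union> fn Q"
| "fn (Par P Q) = fn P \<union> fn Q"
| "fn (Star P) = fn P"
| "fn (Res P L) = fn P - L"

text \<open>
  \<open>rename f P\<close> applies \<open>f\<close> to all names of \<open>P\<close>, free and restricted alike. It is used only with
  bijections \<open>f\<close>, for which no capture can occur.
\<close>

primrec rename :: "('n \<Rightarrow> 'n) \<Rightarrow> 'n xccs \<Rightarrow> 'n xccs" where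
  "rename f Null = Null"
| "rename f END = END"
| "rename f (Pre \<alpha> P) = Pre (map_act f \<alpha>) (rename f P)"
| "rename f (Seq P Q) = Seq (rename f P) (rename f Q)"
| "rename f (Sum P Q) = Sum (rename f P) (rename f Q)"
| "rename f (Par P Q) = Par (rename f P) (rename f Q)"
| "rename f (Star P) = Star (rename f P)"
| "rename f (Res P L) = Res (rename f P) (f ` L)"

text \<open>
  Rule \<open>alpha\<close> is alpha conversion of the restricted names \<open>L\<close> in nominal style: the names are
  permuted by a bijection that fixes every free name of \<open>Res P L\<close>. Since processes are considered
  up to alpha conversion, the names of \<open>P\<close> in the side conditions of \<open>res_par\<close> and \<open>res_void\<close>
  are its free names.
\<close>

inductive rcong :: "'n xccs \<Rightarrow> 'n xccs \<Rightarrow> bool" (infix "\<equiv>\<^sub>r" 50) where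
  refl: "P \<equiv>\<^sub>r P"
| sym: "P \<equiv>\<^sub>r Q \<Longrightarrow> Q \<equiv>\<^sub>r P"
| trans: "P \<equiv>\<^sub>r Q \<Longrightarrow> Q \<equiv>\<^sub>r R \<Longrightarrow> P \<equiv>\<^sub>r R"
| cong_pre: "P \<equiv>\<^sub>r P' \<Longrightarrow> Pre \<alpha> P \<equiv>\<^sub>r Pre \<alpha> P'"
| cong_seq: "P \<equiv>\<^sub>r P' \<Longrightarrow> Q \<equiv>\<^sub>r Q' \<Longrightarrow> Seq P Q \<equiv>\<^sub>r Seq P' Q'"
| cong_sum: "P \<equiv>\<^sub>r P' \<Longrightarrow> Q \<equiv>\<^sub>r Q' \<Longrightarrow> Sum P Q \<equiv>\<^sub>r Sum P' Q'"
| cong_par: "P \<equiv>\<^sub>r P' \<Longrightarrow> Q \<equiv>\<^sub>r Q' \<Longrightarrow> Par P Q \<equiv>\<^sub>r Par P' Q'"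
| cong_star: "P \<equiv>\<^sub>r P' \<Longrightarrow> Star P \<equiv>\<^sub>r Star P'"
| cong_res: "P \<equiv>\<^sub>r P' \<Longrightarrow> Res P L \<equiv>\<^sub>r Res P' L"
| alpha: "bij f \<Longrightarrow> (\<forall>x \<in> fn P - L. f x = x) \<Longrightarrow> Res P L \<equiv>\<^sub>r Res (rename f P) (f ` L)"
| res_null: "Res Null L \<equiv>\<^sub>r Null"
| res_end: "Res END L \<equiv>\<^sub>r END"
| res_pre: "\<alpha> \<notin> vis L \<Longrightarrow> Res (Pre \<alpha> P) L \<equiv>\<^sub>r Pre \<alpha> (Res P L)"
| res_pre_null: "\<alpha> \<in> vis L \<Longrightarrow> Res (Pre \<alpha> P) L \<equiv>\<^sub>r Null"
| res_seq: "Res (Seq P Q) L \<equiv>\<^sub>r Seq (Res P L) (Res Q L)"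
| res_sum: "Res (Sum P Q) L \<equiv>\<^sub>r Sum (Res P L) (Res Q L)"
| res_par: "fn P \<inter> L = {} \<Longrightarrow> Par P (Res Q L) \<equiv>\<^sub>r Res (Par P Q) L"
| res_star: "Res (Star P) L \<equiv>\<^sub>r Star (Res P L)"
| res_res: "Res (Res P L) M \<equiv>\<^sub>r Res P (L \<union> M)"
| res_void: "fn P \<inter> L = {} \<Longrightarrow> Res P L \<equiv>\<^sub>r P"

end

theory Submission
  imports Defs
begin

text \<open>
  The relation \<open>\<equiv>\<^sub>r\<close> is itself a strong bisimulation. By induction on \<open>P \<equiv>\<^sub>r Q\<close>, every
  transition of one side of an axiom is matched by the other side, and the derivatives are again
  related by \<open>\<equiv>\<^sub>r\<close>. The side conditions survive a transition because it only performs free names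
  and creates no new ones. Alpha conversion is handled by equivariance of transitions under
  bijective renaming.
\<close>

text \<open>Puts restriction in terms of names, so that it can be compared with the side conditions
  on \<open>fn\<close>. In particular \<open>Tau\<close>, having no name, is never blocked.\<close>

lemma mem_vis_iff: "\<alpha> \<in> vis L \<longleftrightarrow> act_names \<alpha> \<inter> L \<noteq> {}"
  by (cases \<alpha>) (auto simp: vis_def image_iff)

lemma act_names_co [simp]: "act_names (co \<alpha>) = act_names \<alpha>"
  by (cases \<alpha>) auto

lemma act_names_map_act [simp]: "act_names (map_act f \<alpha>) = f ` act_names \<alpha>"
  by (cases \<alpha>) auto

lemma map_act_co: "map_act f (co \<alpha>) = co (map_act f \<alpha>)"
  by (cases \<alpha>) auto

lemma map_act_eq_Tau_iff [simp]: "map_act f \<alpha> = Tau \<longleftrightarrow> \<alpha> = Tau"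
  by (cases \<alpha>) auto

lemma map_act_fixed: "(\<And>x. x \<in> act_names \<alpha> \<Longrightarrow> f x = x) \<Longrightarrow> map_act f \<alpha> = \<alpha>"
  by (cases \<alpha>) auto

lemma map_act_in_vis_iff: "inj f \<Longrightarrow> map_act f \<alpha> \<in> vis (f ` L) \<longleftrightarrow> \<alpha> \<in> vis L"
  by (simp add: mem_vis_iff image_Int[symmetric])

inductive_cases null_stepE [elim!]: "Null \<midarrow>l\<rightarrow> T"
inductive_cases end_runE [elim!]: "END \<midarrow>Run \<alpha>\<rightarrow> T"
inductive_cases pre_runE [elim!]: "Pre \<beta> P \<midarrow>Run \<alpha>\<rightarrow> T"
inductive_cases pre_endE [elim!]: "Pre \<beta> P \<midarrow>Ending\<rightarrow> T"
inductive_cases star_runE [elim!]: "Star P \<midarrow>Run \<alpha>\<rightarrow> T"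
inductive_cases seq_runE [elim!]: "Seq P Q \<midarrow>Run \<alpha>\<rightarrow> T"
inductive_cases seq_endE [elim!]: "Seq P Q \<midarrow>Ending\<rightarrow> T"
inductive_cases sum_runE [elim!]: "Sum P Q \<midarrow>Run \<alpha>\<rightarrow> T"
inductive_cases sum_endE [elim!]: "Sum P Q \<midarrow>Ending\<rightarrow> T"
inductive_cases par_runE [elim!]: "Par P Q \<midarrow>Run \<alpha>\<rightarrow> T"
inductive_cases par_endE [elim!]: "Par P Q \<midarrow>Ending\<rightarrow> T"
inductive_cases res_runE [elim!]: "Res P L \<midarrow>Run \<alpha>\<rightarrow> T"
inductive_cases res_endE [elim!]: "Res P L \<midarrow>Ending\<rightarrow> T"

text \<open>The critical case is \<open>Res\<close>: an action that passes the restriction has no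
  name in \<open>L\<close>, so its names survive the subtraction in \<open>fn P - L\<close>.\<close>

lemma step_names:
  assumes "P \<midarrow>Run \<alpha>\<rightarrow> Proc P'"
  shows "act_names \<alpha> \<subseteq> fn P" and "fn P' \<subseteq> fn P"
proof -
  have "act_names \<alpha> \<subseteq> fn P \<and> fn P' \<subseteq> fn P"
    using assms
    by (induction P "Run \<alpha>" "Proc P'" arbitrary: \<alpha> P' rule: step.induct)
      (fastforce simp: mem_vis_iff)+
  then show "act_names \<alpha> \<subseteq> fn P" and "fn P' \<subseteq> fn P"
    by auto
qed

lemma step_end_rename:
  "P \<midarrow>Ending\<rightarrow> Done \<Longrightarrow> rename f P \<midarrow>Ending\<rightarrow> Done"
  by (induction P "Ending :: 'a label" "Done :: 'a target" rule: step.induct)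
    (auto intro: step.intros)

lemma step_run_rename:
  assumes "P \<midarrow>Run \<alpha>\<rightarrow> Proc P'" and "inj f"
  shows "rename f P \<midarrow>Run (map_act f \<alpha>)\<rightarrow> Proc (rename f P')"
  using assms
proof (induction P "Run \<alpha>" "Proc P'" arbitrary: \<alpha> P' rule: step.induct)
  case (comm \<alpha> P P' Q Q')
  then show ?case
    using step.comm[of "map_act f \<alpha>"] by (simp add: map_act_co)
qed (auto intro: step.intros step_end_rename simp: map_act_in_vis_iff)

lemma rename_inv_rename: "bij f \<Longrightarrow> rename (inv f) (rename f P) = P"
  by (induction P) (simp_all add: act.map_comp image_comp bij_is_inj act.map_id)

lemma fn_rename: "inj f \<Longrightarrow> fn (rename f P) = f ` fn P"
  by (induction P) (auto simp: image_Un image_set_diff)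

text \<open>Half of the bisimulation condition, with derivatives related by
  \<open>\<equiv>\<^sub>r\<close>. Working with one direction lets a single lemma per operator serve
  both directions of its congruence rule.\<close>

definition matched :: "'n xccs \<Rightarrow> 'n xccs \<Rightarrow> bool" where
  "matched P Q \<longleftrightarrow>
     (\<forall>\<alpha> P'. P \<midarrow>Run \<alpha>\<rightarrow> Proc P' \<longrightarrow> (\<exists>Q'. Q \<midarrow>Run \<alpha>\<rightarrow> Proc Q' \<and> P' \<equiv>\<^sub>r Q')) \<and>
     (P \<midarrow>Ending\<rightarrow> Done \<longrightarrow> Q \<midarrow>Ending\<rightarrow> Done)"

lemma matchedI:
  assumes "\<And>\<alpha> P'. P \<midarrow>Run \<alpha>\<rightarrow> Proc P' \<Longrightarrow> \<exists>Q'. Q \<midarrow>Run \<alpha>\<rightarrow> Proc Q' \<and> P' \<equiv>\<^sub>r Q'"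
    and "P \<midarrow>Ending\<rightarrow> Done \<Longrightarrow> Q \<midarrow>Ending\<rightarrow> Done"
  shows "matched P Q"
  using assms by (auto simp: matched_def)

lemma matched_trans: "matched P Q \<Longrightarrow> matched Q R \<Longrightarrow> matched P R"
  unfolding matched_def by (meson rcong.trans)

lemma matched_alpha:
  assumes "bij f" and fixed: "\<forall>x \<in> fn P - L. f x = x"
  shows "matched (Res P L) (Res (rename f P) (f ` L))"
proof (rule matchedI)
  fix \<alpha> R
  assume "Res P L \<midarrow>Run \<alpha>\<rightarrow> Proc R"
  then obtain P' where P': "P \<midarrow>Run \<alpha>\<rightarrow> Proc P'" "\<alpha> \<notin> vis L" and R: "R = Res P' L"
    by auto
  note inj = bij_is_inj[OF \<open>bij f\<close>]
  note names = step_names[OF P'(1)]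
  \<comment> \<open>The names of \<open>\<alpha>\<close> are free in \<open>P\<close> and lie
    outside \<open>L\<close>, exactly where \<open>f\<close> is the identity.\<close>
  have "map_act f \<alpha> = \<alpha>"
    using P'(2) names(1) fixed by (intro map_act_fixed) (auto simp: mem_vis_iff)
  then have "Res (rename f P) (f ` L) \<midarrow>Run \<alpha>\<rightarrow> Proc (Res (rename f P') (f ` L))"
    using step_run_rename[OF P'(1) inj] map_act_in_vis_iff[OF inj, of \<alpha> L] P'(2)
    by (auto intro: step.res)
  moreover have "R \<equiv>\<^sub>r Res (rename f P') (f ` L)"
    unfolding R using \<open>bij f\<close> fixed names(2) by (intro rcong.alpha) auto
  ultimately show "\<exists>Q'. Res (rename f P) (f ` L) \<midarrow>Run \<alpha>\<rightarrow> Proc Q' \<and> R \<equiv>\<^sub>r Q'"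
    by (intro exI conjI)
qed (auto intro: step.intros step_end_rename)

text \<open>Undoing an alpha conversion is an alpha conversion by \<open>inv f\<close>: a free name
  of the renamed restriction is \<open>f y\<close> for some \<open>y\<close> fixed by
  \<open>f\<close>, so \<open>inv f\<close> fixes it too.\<close>

lemma matched_alpha_sym:
  assumes "bij f" and fixed: "\<forall>x \<in> fn P - L. f x = x"
  shows "matched (Res (rename f P) (f ` L)) (Res P L)"
proof -
  have "\<forall>x \<in> fn (rename f P) - f ` L. inv f x = x"
  proof
    fix x
    assume "x \<in> fn (rename f P) - f ` L"
    then obtain y where "x = f y" "y \<in> fn P - L"
      by (auto simp: fn_rename bij_is_inj[OF \<open>bij f\<close>])
    with fixed show "inv f x = x"
      by (metis inv_f_f bij_is_inj[OF \<open>bij f\<close>])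
  qed
  from matched_alpha[OF bij_imp_bij_inv[OF \<open>bij f\<close>] this] show ?thesis
    by (simp add: rename_inv_rename[OF \<open>bij f\<close>] image_comp bij_is_inj[OF \<open>bij f\<close>])
qed

lemma matched_pre: "P \<equiv>\<^sub>r P' \<Longrightarrow> matched (Pre \<alpha> P) (Pre \<alpha> P')"
  by (auto simp: matched_def intro: step.prefix)

text \<open>When \<open>P\<close> moves, \<open>Q\<close> itself remains in the derivative, so
  relating the derivatives takes \<open>Q \<equiv>\<^sub>r Q'\<close> and not only matching
  transitions. The same happens for \<open>Par\<close> and \<open>Star\<close>, but not for
  \<open>Sum\<close>, which discards the other component.\<close>

lemma matched_seq:
  assumes "matched P P'" "matched Q Q'" "Q \<equiv>\<^sub>r Q'"
  shows "matched (Seq P Q) (Seq P' Q')"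
  using assms unfolding matched_def
  by (safe; blast intro: step.seq1 step.seq2 step.seq_end rcong.cong_seq)

lemma matched_sum:
  assumes "matched P P'" "matched Q Q'"
  shows "matched (Sum P Q) (Sum P' Q')"
  using assms unfolding matched_def
  by (safe; blast intro: step.sum1 step.sum2 step.sum_end1 step.sum_end2)

lemma matched_par:
  assumes "matched P P'" "matched Q Q'" "P \<equiv>\<^sub>r P'" "Q \<equiv>\<^sub>r Q'"
  shows "matched (Par P Q) (Par P' Q')"
  using assms unfolding matched_def
  by (safe; blast intro: step.par1 step.par2 step.comm step.par_end rcong.cong_par)

lemma matched_star:
  assumes "matched P P'" "P \<equiv>\<^sub>r P'"
  shows "matched (Star P) (Star P')"
  using assms unfolding matched_def
  by (safe; blast intro: step.star step.star_end rcong.cong_seq rcong.cong_star)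

lemma matched_res:
  assumes "matched P P'"
  shows "matched (Res P L) (Res P' L)"
  using assms unfolding matched_def
  by (safe; blast intro: step.res step.res_end rcong.cong_res)

text \<open>Relates the derivatives of \<open>Res (Star P) L\<close> and
  \<open>Star (Res P L)\<close>: the restriction is distributed over \<open>Seq\<close> and then
  over \<open>Star\<close>.\<close>

lemma rcong_star_unfolding:
  "Res (Seq P' (Star P)) L \<equiv>\<^sub>r Seq (Res P' L) (Star (Res P L))"
  by (meson rcong.res_seq rcong.cong_seq rcong.refl rcong.res_star rcong.trans)

lemma rcong_res_void_step:
  "fn P \<inter> L = {} \<Longrightarrow> P \<midarrow>Run \<alpha>\<rightarrow> Proc P' \<Longrightarrow> Res P' L \<equiv>\<^sub>r P'"
  using step_names(2) by (blast intro: rcong.res_void)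

text \<open>If the first component moves, the derivatives form another instance of
  \<open>res_seq\<close>; if it ends and the second moves, they coincide.\<close>

lemma matched_res_seq:
  "matched (Res (Seq P Q) L) (Seq (Res P L) (Res Q L))"
  "matched (Seq (Res P L) (Res Q L)) (Res (Seq P Q) L)"
  unfolding matched_def
  by (safe; blast intro: step.seq1 step.seq2 step.seq_end step.res step.res_end
      rcong.refl rcong.res_seq rcong.sym[OF rcong.res_seq])+

lemma matched_res_sum:
  "matched (Res (Sum P Q) L) (Sum (Res P L) (Res Q L))"
  "matched (Sum (Res P L) (Res Q L)) (Res (Sum P Q) L)"
  unfolding matched_def
  by (safe; blast intro: step.sum1 step.sum2 step.sum_end1 step.sum_end2 step.res step.res_end
      rcong.refl)+

lemma matched_res_star:
  "matched (Res (Star P) L) (Star (Res P L))"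
  "matched (Star (Res P L)) (Res (Star P) L)"
  unfolding matched_def
  by (safe; blast intro: step.star step.star_end step.res step.res_end
      rcong_star_unfolding rcong.sym[OF rcong_star_unfolding])+

lemma matched_res_res:
  "matched (Res (Res P L) M) (Res P (L \<union> M))"
  "matched (Res P (L \<union> M)) (Res (Res P L) M)"
proof -
  \<comment> \<open>Passing two nested restrictions is the same as passing the restriction by the
    union.\<close>
  have visD: "\<alpha> \<in> vis (L \<union> M) \<Longrightarrow> \<alpha> \<in> vis L \<or> \<alpha> \<in> vis M"
    and visI: "\<alpha> \<in> vis L \<Longrightarrow> \<alpha> \<in> vis (L \<union> M)" "\<alpha> \<in> vis M \<Longrightarrow> \<alpha> \<in> vis (L \<union> M)" for \<alpha>
    by (auto simp: mem_vis_iff)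
  show "matched (Res (Res P L) M) (Res P (L \<union> M))"
    unfolding matched_def
    by (safe; blast intro: step.res step.res_end rcong.res_res dest: visD)
  show "matched (Res P (L \<union> M)) (Res (Res P L) M)"
    unfolding matched_def
    by (safe; blast intro: step.res step.res_end rcong.sym[OF rcong.res_res] visI)
qed

lemma matched_res_void:
  assumes "fn P \<inter> L = {}"
  shows "matched (Res P L) P" and "matched P (Res P L)"
proof -
  have vis: False if "\<alpha> \<in> vis L" "P \<midarrow>Run \<alpha>\<rightarrow> Proc P'" for \<alpha> P'
    using step_names(1)[OF that(2)] that(1) assms by (auto simp: mem_vis_iff)
  show "matched (Res P L) P"
    unfolding matched_def
    by (safe; blast intro: rcong_res_void_step[OF assms])
  show "matched P (Res P L)"
    unfolding matched_def
    by (safe; blast intro: step.res step.res_end rcong.sym[OF rcong_res_void_step[OF assms]]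
        dest: vis)
qed

lemma matched_res_par:
  assumes "fn P \<inter> L = {}"
  shows "matched (Par P (Res Q L)) (Res (Par P Q) L)"
    and "matched (Res (Par P Q) L) (Par P (Res Q L))"
proof -
  \<comment> \<open>The disjunct on \<open>co \<alpha>\<close> concerns communication: as
    \<open>P\<close> never offers an action on a name in \<open>L\<close>, its partner action from
    \<open>Q\<close> is not blocked when the restriction is moved onto \<open>Q\<close>
    alone.\<close>
  have vis: False if "\<alpha> \<in> vis L \<or> co \<alpha> \<in> vis L" "P \<midarrow>Run \<alpha>\<rightarrow> Proc P'" for \<alpha> P'
    using step_names(1)[OF that(2)] that(1) assms by (auto simp: mem_vis_iff)
  have ext: "Par P' (Res R L) \<equiv>\<^sub>r Res (Par P' R) L" if "P \<midarrow>Run \<alpha>\<rightarrow> Proc P'" for \<alpha> P' R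
    using step_names(2)[OF that] assms by (blast intro: rcong.res_par)
  \<comment> \<open>Lets the result of a communication through the outer restriction.\<close>
  have tau: "Tau \<in> vis L \<Longrightarrow> False"
    by (simp add: mem_vis_iff)
  note intros = step.par1 step.par2 step.comm step.par_end step.res step.res_end
  note dests = vis[OF disjI1] vis[OF disjI2] tau
  show "matched (Par P (Res Q L)) (Res (Par P Q) L)"
    unfolding matched_def
    by (safe; blast intro: intros ext rcong.res_par[OF assms] dest: dests)
  show "matched (Res (Par P Q) L) (Par P (Res Q L))"
    unfolding matched_def
    by (safe; blast intro: intros rcong.sym[OF ext] rcong.sym[OF rcong.res_par[OF assms]]
        dest: dests)
qed

text \<open>Claiming both orders at once makes the symmetry case immediate and gives transitivity by
  composing in each direction.\<close>

lemma rcong_matched: "P \<equiv>\<^sub>r Q \<Longrightarrow> matched P Q \<and> matched Q P"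
proof (induction rule: rcong.induct)
  case (refl P)
  then show ?case
    by (auto simp: matched_def intro: rcong.refl)
next
  case (trans P Q R)
  then show ?case
    by (blast intro: matched_trans)
next
  case (cong_pre P P' \<alpha>)
  then show ?case
    by (simp add: matched_pre rcong.sym)
next
  case (cong_seq P P' Q Q')
  then show ?case
    by (simp add: matched_seq rcong.sym)
next
  case (cong_par P P' Q Q')
  then show ?case
    by (simp add: matched_par rcong.sym)
next
  case (cong_star P P')
  then show ?case
    by (simp add: matched_star rcong.sym)
next
  case (res_pre \<alpha> L P)
  then show ?case
    by (auto simp: matched_def intro: step.prefix step.res rcong.refl)
next
  case (res_pre_null \<alpha> L P)
  then show ?case
    by (auto simp: matched_def)
next
  case (res_null L)
  then show ?case
    by (auto simp: matched_def)
next
  case (res_end L)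
  then show ?case
    by (auto simp: matched_def intro: step.res_end step.end_end)
qed (simp_all add: matched_sum matched_res matched_alpha matched_alpha_sym matched_res_seq
      matched_res_sum matched_res_par matched_res_star matched_res_res matched_res_void)

theorem theorem5p10:
  fixes P Q :: "'n xccs"
  assumes "P \<equiv>\<^sub>r Q"
  shows "P \<sim> Q"
proof -
  have "strong_bisimulation {(P :: 'n xccs, Q). P \<equiv>\<^sub>r Q}"
    unfolding strong_bisimulation_def
    \<comment> \<open>Moves of \<open>Q\<close> are answered through \<open>matched Q P\<close>,
      whose related derivatives come in reversed order; \<open>rcong.sym\<close> turns them
      around.\<close>
    using rcong_matched by (fastforce simp: matched_def intro: rcong.sym)
  with assms show ?thesis
    by (auto simp: bisimilar_def)
qed

end
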